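(* Let $m,k\in\mathbb{N}$ with $k\ge 2$, and let $T\subseteq\Sigma_m^*$ be a finite tree with $k$ terminal nodes $\tau_0,\dots,\tau_{k-1}$. Let $\ell_T$ be the length function induced by $T$ and let $F_T$ be the self-similar fractal tree generated by $T$. Then the channel capacity of $\ell_T$ is equal to $\log(m)\cdot\mathrm{sdim}(F_T)$, where $\mathrm{sdim}(F_T)$ is the similarity dimension of $F_T$. In particular, if $m=2$, the channel capacity of $\ell_T$ is equal to $\mathrm{sdim}(F_T)$.
   Context: Logarithms are to base 2. $\Sigma_m=\{0,1,\dots,m-1\}$; $\Sigma_m^*$ is the set of finite strings and $\Sigma_m^\infty$ the set of infinite sequences over $\Sigma_m$; $|\sigma|$ is the number of symbols of the string $\sigma$. A tree is a subset of $\Sigma_m^*$ closed under taking initial segments. A finite tree $T$ is specified by a finite prefix-free set $S\subseteq\Sigma_m^*$ (no element of $S$ is a proper initial segment of another), $T$ being the set of all initial segments of elements of $S$; the elements of $S$ are the terminal nodes of $T$. The infinite tree $T^*$ is obtained from $T$ by concatenating a copy of $T$ at each terminal node and repeating recursively; i.e. $T^*$ is the set of all initial segments of finite concatenations of terminal nodes of $T$. The self-similar fractal tree generated by $T$ is $F_T=[T^*]$, the set of $x\in\Sigma_m^\infty$ all of whose finite initial segments lie in $T^*$. The copy of $F_T$ above the terminal node $\tau_i$ has similarity ratio $m^{-|\tau_i|}$ (with respect to the metric on $\Sigma_m^\infty$ in which two sequences that first differ after agreeing on exactly $j$ symbols have distance $m^{-j}$). The similarity dimension $\mathrm{sdim}(F_T)$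 is the unique real number $\beta$ satisfying $\sum_{i=0}^{k-1}m^{-\beta|\tau_i|}=1$. A length function on $\Sigma_k$ is a function $\ell:\Sigma_k\to\mathbb{N}$. The channel capacity of $\ell$ is the unique real $\alpha\ge 0$ with $\sum_{i=0}^{k-1}2^{-\alpha\ell(i)}=1$. The length function induced by $T$ is $\ell_T:\Sigma_k\to\mathbb{N}$, $\ell_T(i)=|\tau_i|$. *)

theory Defs
  imports Complex_Main "HOL-Library.Sublist" "HOL-Library.Stream"
begin

text \<open>
  The alphabet \<open>\<Sigma>\<^sub>m\<close> is \<open>{..<m}\<close>; finite strings over it are the elements of \<open>lists {..<m}\<close> and
  infinite sequences over it the elements of \<open>streams {..<m}\<close>.
\<close>

definition is_tree :: "nat \<Rightarrow> nat list set \<Rightarrow> bool" where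
  "is_tree m T \<longleftrightarrow> T \<subseteq> lists {..<m} \<and> (\<forall>\<sigma>\<in>T. \<forall>\<rho>. prefix \<rho> \<sigma> \<longrightarrow> \<rho> \<in> T)"

definition prefix_free :: "'a list set \<Rightarrow> bool" where
  "prefix_free S \<longleftrightarrow> (\<forall>\<sigma>\<in>S. \<forall>\<tau>\<in>S. \<not> strict_prefix \<sigma> \<tau>)"

definition initial_segments :: "'a list set \<Rightarrow> 'a list set" where
  "initial_segments S = {\<rho>. \<exists>\<sigma>\<in>S. prefix \<rho> \<sigma>}"

definition finite_tree :: "nat \<Rightarrow> nat list set \<Rightarrow> bool" where
  "finite_tree m T \<longleftrightarrow>
     (\<exists>S. finite S \<and> S \<subseteq> lists {..<m} \<and> prefix_free S \<and> T = initial_segments S)"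

text \<open>
  The set \<open>S\<close> specifying a finite tree is recovered from the tree as its set of maximal
  elements; see \<open>terminal_nodes_initial_segments\<close> below.
\<close>

definition terminal_nodes :: "'a list set \<Rightarrow> 'a list set" where
  "terminal_nodes T = {\<sigma> \<in> T. \<forall>\<rho>\<in>T. \<not> strict_prefix \<sigma> \<rho>}"

lemma terminal_nodes_initial_segments:
  assumes "prefix_free S"
  shows "terminal_nodes (initial_segments S) = S"
proof (intro set_eqI iffI)
  fix x assume "x \<in> terminal_nodes (initial_segments S)"
  then obtain s where "s \<in> S" "prefix x s" "\<not> strict_prefix x s"
    by (auto simp: terminal_nodes_def initial_segments_def)
  then show "x \<in> S" by (auto simp: strict_prefix_def)
next
  fix x assume x: "x \<in> S"
  then have "\<not> strict_prefix x r" if "s \<in> S" "prefix r s" for r s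
    using assms that unfolding prefix_free_def
    by (meson prefix_order.less_le_trans)
  with x show "x \<in> terminal_nodes (initial_segments S)"
    by (auto simp: terminal_nodes_def initial_segments_def)
qed

lemma finite_tree_iff: "finite_tree m T \<longleftrightarrow> is_tree m T \<and> finite T"
proof
  assume "finite_tree m T"
  then obtain S where S: "finite S" "S \<subseteq> lists {..<m}" "T = initial_segments S"
    by (auto simp: finite_tree_def)
  have "T = (\<Union>s\<in>S. set (prefixes s))"
    unfolding S(3) initial_segments_def by auto
  then have "finite T" using S(1) by simp
  have "\<rho> \<in> lists {..<m}" if \<rho>: "\<rho> \<in> T" for \<rho>
  proof -
    obtain s where s: "s \<in> S" "prefix \<rho> s" using \<rho> unfolding S(3) initial_segments_def by blast
    then have "set \<rho> \<subseteq> set s" by (simp add: set_mono_prefix)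
    moreover have "set s \<subseteq> {..<m}" using S(2) s(1) by blast
    ultimately show ?thesis by blast
  qed
  moreover have "\<rho> \<in> T" if "\<sigma> \<in> T" "prefix \<rho> \<sigma>" for \<rho> \<sigma>
    using that unfolding S(3) initial_segments_def by (blast intro: prefix_order.trans)
  ultimately have "is_tree m T" unfolding is_tree_def by blast
  with \<open>finite T\<close> show "is_tree m T \<and> finite T" by blast
next
  assume a: "is_tree m T \<and> finite T"
  have ext: "\<exists>\<sigma>\<in>terminal_nodes T. prefix \<rho> \<sigma>" if "\<rho> \<in> T" for \<rho>
  proof -
    let ?A = "{\<sigma> \<in> T. prefix \<rho> \<sigma>}"
    have fin: "finite (length ` ?A)" "length ` ?A \<noteq> {}" using a that by auto
    then obtain \<sigma> where \<sigma>: "\<sigma> \<in> ?A" "length \<sigma> = Max (length ` ?A)"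
      using Max_in[OF fin] by (metis (no_types, lifting) imageE)
    have "\<not> strict_prefix \<sigma> x" if "x \<in> T" for x
    proof
      assume sp: "strict_prefix \<sigma> x"
      then have "x \<in> ?A" using that \<sigma>(1)
        by (auto intro: prefix_order.trans prefix_order.less_imp_le)
      then have "length x \<le> length \<sigma>" using fin \<sigma>(2) by auto
      then show False using sp by (auto dest: prefix_length_less)
    qed
    then show ?thesis using \<sigma>(1) by (auto simp: terminal_nodes_def)
  qed
  have "T = initial_segments (terminal_nodes T)"
    using ext a by (auto simp: initial_segments_def is_tree_def terminal_nodes_def)
  moreover have "prefix_free (terminal_nodes T)"
    by (auto simp: prefix_free_def terminal_nodes_def)
  moreover have "finite (terminal_nodes T)" "terminal_nodes T \<subseteq> lists {..<m}"
    using a by (auto simp: terminal_nodes_def is_tree_def)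
  ultimately show "finite_tree m T" unfolding finite_tree_def by blast
qed

definition star_tree :: "'a list set \<Rightarrow> 'a list set" where
  "star_tree T = initial_segments (concat ` lists (terminal_nodes T))"

definition fractal_tree :: "nat \<Rightarrow> nat list set \<Rightarrow> nat stream set" where
  "fractal_tree m T = {x \<in> streams {..<m}. \<forall>n. stake n x \<in> star_tree T}"

definition seq_dist :: "nat \<Rightarrow> nat stream \<Rightarrow> nat stream \<Rightarrow> real" where
  "seq_dist m x y = (if x = y then 0 else real m powr - real (LEAST j. x !! j \<noteq> y !! j))"

text \<open>
  The next two facts are the source of the equation defining \<open>sdim\<close>: the fractal tree is the
  union of the copies of itself above the terminal nodes, and the copy above \<open>\<sigma>\<close> has
  similarity ratio \<open>m\<close> to the power \<open>- length \<sigma>\<close>.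
\<close>

lemma fractal_tree_decomposition:
  assumes "finite_tree m T"
  shows "fractal_tree m T = (\<Union>\<sigma>\<in>terminal_nodes T. shift \<sigma> ` fractal_tree m T)"
proof -
  let ?S = "terminal_nodes T"
  have S: "finite ?S" "?S \<subseteq> lists {..<m}" "prefix_free ?S"
    using assms unfolding finite_tree_def by (auto simp: terminal_nodes_initial_segments)
  have pf: "s = s'" if "s \<in> ?S" "s' \<in> ?S" "prefix s z" "prefix s' z" for s s' z
    using S(3) that prefix_same_cases[of s z s'] unfolding prefix_free_def
    by (auto simp: strict_prefix_def)
  have starD: "\<exists>ws\<in>lists ?S. prefix u (concat ws)" if "u \<in> star_tree T" for u
    using that by (auto simp: star_tree_def initial_segments_def)
  have starI: "u \<in> star_tree T" if "ws \<in> lists ?S" "prefix u (concat ws)" for u ws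
    using that by (auto simp: star_tree_def initial_segments_def)
  show ?thesis
  proof (intro set_eqI iffI)
    fix x assume x: "x \<in> fractal_tree m T"
    have xs: "x \<in> streams {..<m}" and xn: "stake n x \<in> star_tree T" for n
      using x by (auto simp: fractal_tree_def)
    obtain N where N: "\<And>s. s \<in> ?S \<Longrightarrow> length s \<le> N"
    proof
      show "length s \<le> Max (length ` ?S)" if "s \<in> ?S" for s using S(1) that by simp
    qed
    have first: "\<exists>s\<in>?S. \<exists>ws\<in>lists ?S. prefix s (stake n x) \<and> prefix (stake n x) (s @ concat ws)"
      if n: "n > N" for n
    proof -
      obtain ws where ws: "ws \<in> lists ?S" "prefix (stake n x) (concat ws)"
        using starD[OF xn] by blast
      have "ws \<noteq> []" using ws(2) n by auto
      then obtain s vs where sv: "ws = s # vs" by (cases ws) auto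
      have "prefix s (stake n x)"
      proof (rule prefix_length_prefix)
        show "prefix s (concat ws)" using sv by simp
        show "prefix (stake n x) (concat ws)" by (fact ws)
        show "length s \<le> length (stake n x)" using ws(1) sv N[of s] n by simp
      qed
      then show ?thesis using ws sv by auto
    qed
    obtain s where s: "s \<in> ?S" "prefix s (stake (Suc N) x)" using first[of "Suc N"] by auto
    have sx: "stake (length s) x = s"
    proof -
      obtain z where z: "stake (Suc N) x = s @ z" using s(2) by (auto simp: prefix_def)
      have "stake (length s) x = take (length s) (stake (Suc N) x)"
        using N[OF s(1)] by (simp add: take_stake min_def del: stake.simps)
      then show ?thesis unfolding z by simp
    qed
    define y where "y = sdrop (length s) x"
    have xy: "x = s @- y" unfolding y_def using sx by (metis stake_sdrop)
    have "stake n y \<in> star_tree T" for n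
    proof -
      let ?l = "Suc N + length s + n"
      obtain s' ws where s': "s' \<in> ?S" "ws \<in> lists ?S" "prefix s' (stake ?l x)"
        "prefix (stake ?l x) (s' @ concat ws)" using first[of ?l] by auto
      have "stake ?l x = s @ stake (Suc N + n) y"
        unfolding xy by (simp add: stake_shift)
      then have ps: "prefix s (stake ?l x)" by simp
      have eq: "s' = s" using pf[OF s'(1) s(1) s'(3) ps] .
      then have "prefix (stake (Suc N + n) y) (concat ws)"
        using s'(4) \<open>stake ?l x = s @ stake (Suc N + n) y\<close> by simp
      moreover have "prefix (stake n y) (stake (Suc N + n) y)"
        by (metis add.commute prefixI stake_add)
      ultimately show ?thesis using starI[OF s'(2)] prefix_order.trans by blast
    qed
    moreover have "y \<in> streams {..<m}" using xs unfolding xy by (simp add: streams_iff_sset)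
    ultimately have "y \<in> fractal_tree m T" by (simp add: fractal_tree_def)
    then show "x \<in> (\<Union>\<sigma>\<in>?S. shift \<sigma> ` fractal_tree m T)" using s xy by auto
  next
    fix x assume "x \<in> (\<Union>\<sigma>\<in>?S. shift \<sigma> ` fractal_tree m T)"
    then obtain s y where s: "s \<in> ?S" "x = s @- y" "y \<in> fractal_tree m T" by auto
    have "stake n x \<in> star_tree T" for n
    proof -
      have "stake n y \<in> star_tree T" using s(3) by (simp add: fractal_tree_def)
      then obtain ws where ws: "ws \<in> lists ?S" "prefix (stake n y) (concat ws)"
        using starD by blast
      have "prefix (stake n x) (stake (n + length s) x)"
        by (metis prefixI stake_add)
      also have "stake (n + length s) x = s @ stake n y" unfolding s(2) by (simp add: stake_shift)
      also have "prefix \<dots> (concat (s # ws))" using ws by simp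
      finally show ?thesis using starI[of "s # ws"] ws s by auto
    qed
    moreover have "x \<in> streams {..<m}"
      using s S(2) by (auto simp: fractal_tree_def intro!: shift_streams)
    ultimately show "x \<in> fractal_tree m T" by (simp add: fractal_tree_def)
  qed
qed

lemma seq_dist_shift:
  "seq_dist m (\<sigma> @- x) (\<sigma> @- y) = real m powr - real (length \<sigma>) * seq_dist m x y"
proof (cases "x = y")
  case True then show ?thesis by (simp add: seq_dist_def)
next
  case False
  then have ne: "\<sigma> @- x \<noteq> \<sigma> @- y" by simp
  obtain j where j: "x !! j \<noteq> y !! j" using False smap_alt[of id x y] by (auto simp: stream.map_id)
  let ?P = "\<lambda>j. x !! j \<noteq> y !! j"
  have "(LEAST j. (\<sigma> @- x) !! j \<noteq> (\<sigma> @- y) !! j) = length \<sigma> + (LEAST j. ?P j)"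
  proof (rule Least_equality)
    show "(\<sigma> @- x) !! (length \<sigma> + (LEAST j. ?P j)) \<noteq> (\<sigma> @- y) !! (length \<sigma> + (LEAST j. ?P j))"
      using LeastI[of ?P, OF j] by simp
  next
    fix i assume i: "(\<sigma> @- x) !! i \<noteq> (\<sigma> @- y) !! i"
    then have "length \<sigma> \<le> i" by (metis not_le shift_snth_less)
    then show "length \<sigma> + (LEAST j. ?P j) \<le> i"
      using i Least_le[of ?P "i - length \<sigma>"] by simp
  qed
  then show ?thesis using False ne
    by (simp add: seq_dist_def flip: powr_add)
qed

text \<open>
  The similarity dimension of \<open>fractal_tree m T\<close>. It belongs to the decomposition of the fractal
  tree into copies given by the generating tree, hence the argument \<open>T\<close>.
\<close>

definition sdim :: "nat \<Rightarrow> nat list set \<Rightarrow> real" where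
  "sdim m T = (THE \<beta>. (\<Sum>\<sigma>\<in>terminal_nodes T. real m powr (- \<beta> * real (length \<sigma>))) = 1)"

text \<open>A length function on \<open>\<Sigma>\<^sub>k\<close> is a function on \<open>nat\<close> of which only the values below \<open>k\<close> matter.\<close>

definition channel_capacity :: "nat \<Rightarrow> (nat \<Rightarrow> nat) \<Rightarrow> real" where
  "channel_capacity k l =
     (THE \<alpha>. \<alpha> \<ge> 0 \<and> (\<Sum>i<k. 2 powr (- \<alpha> * real (l i))) = 1)"

definition induced_length :: "(nat \<Rightarrow> 'a list) \<Rightarrow> nat \<Rightarrow> nat" where
  "induced_length \<tau> i = length (\<tau> i)"

end

theory Submission imports Defs begin

text \<open>
  The channel capacity and the similarity dimension solve the same equation up to a change of
  base: \<open>m powr (- \<beta> * l) = 2 powr (- (log 2 m * \<beta>) * l)\<close>, so \<open>\<beta>\<close> solves the equation of the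
  similarity dimension exactly when \<open>log 2 m * \<beta>\<close> solves that of the channel capacity.  As both
  notions are defined by a definite description, the substance lies in showing that each equation
  has exactly one solution (\<open>ex1_powr_sum_eq_1\<close>): for positive lengths and a base above 1 the
  left-hand side is continuous and strictly decreasing, is the number of terms at 0 and at most 1
  for large exponents.

  The hypotheses of that argument come from prefix-freeness: two distinct incomparable strings are
  nonempty, and they need two different letters to branch apart, which forces \<open>m \<ge> 2\<close>.
\<close>

lemma powr_sum_strict_antimono:
  fixes b :: real and l :: "'a \<Rightarrow> nat"
  assumes "finite A" "A \<noteq> {}" "b > 1" "\<And>i. i \<in> A \<Longrightarrow> 0 < l i" "x < y"
  shows "(\<Sum>i\<in>A. b powr (- y * real (l i))) < (\<Sum>i\<in>A. b powr (- x * real (l i)))"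
  using assms by (intro sum_strict_mono) auto

text \<open>
  The channel capacity is sought among the nonnegative reals and the similarity dimension among
  all reals; this lemma makes the two searches the same.  At a negative exponent the sum would
  exceed its value at 0, the number of terms.
\<close>

lemma powr_sum_eq_1_nonneg:
  fixes b :: real and l :: "'a \<Rightarrow> nat"
  assumes "finite A" "A \<noteq> {}" "b > 1" "\<And>i. i \<in> A \<Longrightarrow> 0 < l i"
    and root: "(\<Sum>i\<in>A. b powr (- x * real (l i))) = 1"
  shows "0 \<le> x"
proof (rule ccontr)
  assume "\<not> 0 \<le> x"
  then have "(\<Sum>i\<in>A. b powr (- 0 * real (l i))) < (\<Sum>i\<in>A. b powr (- x * real (l i)))"
    using assms by (intro powr_sum_strict_antimono) auto
  then have "real (card A) < 1"
    using root \<open>b > 1\<close> by simp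
  moreover have "card A \<ge> 1"
    using assms(1,2) by (simp add: Suc_le_eq card_gt_0_iff)
  ultimately show False by simp
qed

text \<open>
  Existence is the intermediate value theorem on the interval from 0 to the base-\<open>b\<close> logarithm of
  the number of terms; at its right end no term exceeds the reciprocal of that number, since
  every length is at least 1.
\<close>

lemma ex1_powr_sum_eq_1:
  fixes b :: real and l :: "'a \<Rightarrow> nat"
  assumes "finite A" "A \<noteq> {}" "b > 1" "\<And>i. i \<in> A \<Longrightarrow> 0 < l i"
  shows "\<exists>!x. (\<Sum>i\<in>A. b powr (- x * real (l i))) = 1"
proof -
  define f where "f x = (\<Sum>i\<in>A. b powr (- x * real (l i)))" for x
  define c where "c = log b (real (card A))"
  have card: "card A \<ge> 1"
    using assms(1,2) by (simp add: Suc_le_eq card_gt_0_iff)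
  have "0 \<le> c"
    using card \<open>b > 1\<close> by (simp add: c_def zero_le_log_cancel_iff)
  have "f 0 = real (card A)"
    using \<open>b > 1\<close> by (simp add: f_def)
  have "f c \<le> (\<Sum>i\<in>A. 1 / real (card A))"
    unfolding f_def
  proof (rule sum_mono)
    fix i assume "i \<in> A"
    then have "c * 1 \<le> c * real (l i)"
      using assms(4)[of i] \<open>0 \<le> c\<close> by (intro mult_left_mono) auto
    then have "b powr (- c * real (l i)) \<le> b powr (- c)"
      using \<open>b > 1\<close> by simp
    also have "\<dots> = 1 / real (card A)"
      using \<open>b > 1\<close> card by (simp add: c_def powr_minus_divide)
    finally show "b powr (- c * real (l i)) \<le> 1 / real (card A)" .
  qed
  then have "f c \<le> 1"
    using card by simp
  have "\<forall>x. 0 \<le> x \<and> x \<le> c \<longrightarrow> isCont f x"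
    unfolding f_def using \<open>b > 1\<close> by (auto intro!: continuous_intros)
  then obtain x where "f x = 1"
    using IVT2[of f c 1 0] \<open>f c \<le> 1\<close> \<open>f 0 = real (card A)\<close> card \<open>0 \<le> c\<close> by auto
  moreover have "y = z" if "f y = 1" "f z = 1" for y z
    using powr_sum_strict_antimono[OF assms(1-3), of l y z]
      powr_sum_strict_antimono[OF assms(1-3), of l z y] assms(4) that
    unfolding f_def by (cases y z rule: linorder_cases) auto
  ultimately show ?thesis
    unfolding f_def by blast
qed

lemma prefix_free_length_pos:
  assumes "prefix_free S" "card S \<ge> 2" "\<sigma> \<in> S"
  shows "0 < length \<sigma>"
proof -
  have "\<not> S \<subseteq> {\<sigma>}"
    using assms(2) card_mono[of "{\<sigma>}" S] by auto
  then obtain \<rho> where "\<rho> \<in> S" "\<rho> \<noteq> \<sigma>"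
    using assms(3) by blast
  then show ?thesis
    using assms(1,3) unfolding prefix_free_def strict_prefix_def by fastforce
qed

text \<open>Over at most one letter the strings are powers of that letter, hence pairwise comparable.\<close>

lemma prefix_free_alphabet_ge_2:
  fixes m :: nat
  assumes "prefix_free S" "card S \<ge> 2" "S \<subseteq> lists {..<m}"
  shows "m \<ge> 2"
proof (rule ccontr)
  assume "\<not> m \<ge> 2"
  then have power: "\<sigma> = replicate (length \<sigma>) 0" if "\<sigma> \<in> S" for \<sigma>
    using assms(3) that by (intro replicate_eqI) force+
  obtain \<sigma> \<rho> where "\<sigma> \<in> S" "\<rho> \<in> S" "\<sigma> \<noteq> \<rho>"
    using assms(2) card_le_Suc0_iff_eq[of S] card.infinite[of S] by fastforce
  moreover have "prefix (replicate i 0) (replicate j (0::nat))" if "i \<le> j" for i j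
    using that by (metis le_add_diff_inverse prefixI replicate_add)
  then have "prefix \<sigma> \<rho> \<or> prefix \<rho> \<sigma>"
    using power[OF \<open>\<sigma> \<in> S\<close>] power[OF \<open>\<rho> \<in> S\<close>] by (metis nat_le_linear)
  ultimately show False
    using assms(1) unfolding prefix_free_def strict_prefix_def by blast
qed

theorem theorem4p1:
  fixes m k :: nat and T :: "nat list set" and \<tau> :: "nat \<Rightarrow> nat list"
  assumes "k \<ge> 2"
    and "finite_tree m T"
    and "bij_betw \<tau> {..<k} (terminal_nodes T)"
  shows "channel_capacity k (induced_length \<tau>) = log 2 (real m) * sdim m T \<and>
         (m = 2 \<longrightarrow> channel_capacity k (induced_length \<tau>) = sdim m T)"
proof -
  let ?S = "terminal_nodes T"
  let ?l = "induced_length \<tau>"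
  let ?\<alpha> = "log 2 (real m) * sdim m T"
  have S: "finite ?S" "?S \<subseteq> lists {..<m}" "prefix_free ?S"
    using assms(2) unfolding finite_tree_def by (auto simp: terminal_nodes_initial_segments)
  have card: "card ?S \<ge> 2"
    using bij_betw_same_card[OF assms(3)] assms(1) by simp
  have m: "m \<ge> 2"
    using prefix_free_alphabet_ge_2[OF S(3) card S(2)] .
  have pos: "0 < length \<sigma>" if "\<sigma> \<in> ?S" for \<sigma>
    using prefix_free_length_pos[OF S(3) card that] .
  have l_pos: "0 < ?l i" if "i \<in> {..<k}" for i
    using pos bij_betwE[OF assms(3)] that by (simp add: induced_length_def)
  have k: "{..<k} \<noteq> {}"
    using assms(1) by (simp add: lessThan_empty_iff)

  have "\<exists>!\<beta>. (\<Sum>\<sigma>\<in>?S. real m powr (- \<beta> * real (length \<sigma>))) = 1"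
    using S(1) card m pos by (intro ex1_powr_sum_eq_1) auto
  from theI'[OF this]
  have "(\<Sum>\<sigma>\<in>?S. real m powr (- sdim m T * real (length \<sigma>))) = 1"
    unfolding sdim_def .
  also have "(\<Sum>\<sigma>\<in>?S. real m powr (- sdim m T * real (length \<sigma>))) =
      (\<Sum>i<k. real m powr (- sdim m T * real (?l i)))"
    unfolding induced_length_def by (rule sum.reindex_bij_betw[OF assms(3), symmetric])
  also have "\<dots> = (\<Sum>i<k. 2 powr (- ?\<alpha> * real (?l i)))"
  proof (rule sum.cong)
    fix i
    have "real m powr (- sdim m T * real (?l i))
        = (2 powr log 2 (real m)) powr (- sdim m T * real (?l i))"
      using m by simp
    also have "\<dots> = 2 powr (- ?\<alpha> * real (?l i))"
      by (simp add: powr_powr mult.assoc del: powr_log_cancel)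
    finally show "real m powr (- sdim m T * real (?l i)) = 2 powr (- ?\<alpha> * real (?l i))" .
  qed simp
  finally have root: "(\<Sum>i<k. 2 powr (- ?\<alpha> * real (?l i))) = 1" .

  have "0 \<le> ?\<alpha>"
    using powr_sum_eq_1_nonneg[OF finite_lessThan k _ l_pos root] by simp
  moreover have "\<exists>!\<alpha>. (\<Sum>i<k. 2 powr (- \<alpha> * real (?l i))) = 1"
    using k l_pos by (intro ex1_powr_sum_eq_1) auto
  ultimately have "channel_capacity k ?l = ?\<alpha>"
    unfolding channel_capacity_def using root by (intro the_equality) blast+
  then show ?thesis
    by simp
qed

end
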